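(* Let $\mu_1,\mu_2,\mu_3,\mu_4>0$ with $\mu_1=\mu_3$ and $\mu_2=\mu_4$. Consider the central configurations $(\theta_1,\theta_2,\theta_3,\theta_4)$ of the planar $1+4$ body problem associated to the mass parameters $\mu_1,\mu_2,\mu_3,\mu_4$ that satisfy $\theta_1=\theta_4$ and $\theta_2=\theta_3=\pi-\theta_1$, where the tuples $(\theta_1,\pi-\theta_1,\pi-\theta_1,\theta_1)$ and $(\pi-\theta_1,\theta_1,\theta_1,\pi-\theta_1)$ are regarded as the same configuration. (1) If $\mu_2/\mu_1\leq \frac{3\sqrt{2}}{7}$, there is a unique such central configuration: the square $\theta_i=\pi/2$, $i=1,2,3,4$. (2) If $\mu_2/\mu_1>\frac{3\sqrt{2}}{7}$, there are exactly two such central configurations: the square and a kite $(\theta_1,\pi-\theta_1,\pi-\theta_1,\theta_1)$ with $\theta_1\in(\pi/6,\pi/2)$. Moreover, the function from $\left(\frac{3\sqrt{2}}{7},+\infty\right)$ to $(\pi/6,\pi/2)$ that maps $\mu_2/\mu_1$ to the angle $\theta_1\in(\pi/6,\pi/2)$ of the kite configuration in (2) is bijective.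
   Context: In the planar $1+4$ body problem, a massive body sits at the center of a circle and four satellites, with infinitesimal-mass parameters $\mu_1,\mu_2,\mu_3,\mu_4\in\mathbb{R}^+$ (positive reals), lie on the circle in cyclic order at distinct points. The coordinates are the angles between consecutive satellites: $\theta_i$ is the angle from satellite $i$ to satellite $i+1$ for $i=1,2,3$, and $\theta_4$ is the angle from satellite $4$ to satellite $1$. Thus $\theta_i>0$ for all $i$ and $\theta_1+\theta_2+\theta_3+\theta_4=2\pi$. Define $f:(0,2\pi)\to\mathbb{R}$ by $f(x)=\sin(x)\left(1-\frac{1}{8|\sin^3(x/2)|}\right)$. Definition: given $\mu_1,\dots,\mu_4>0$, a central configuration of the planar $1+4$ body problem associated to the mass parameters $\mu_1,\mu_2,\mu_3,\mu_4$ is a tuple $(\theta_1,\theta_2,\theta_3,\theta_4)$ with all $\theta_i>0$ and $\theta_1+\theta_2+\theta_3+\theta_4=2\pi$ that satisfies $$\mu_2f(\theta_1)+\mu_3f(\theta_1+\theta_2)+\mu_4f(\theta_1+\theta_2+\theta_3)=0,$$ $$\mu_3f(\theta_2)+\mu_4f(\theta_2+\theta_3)+\mu_1f(\theta_2+\theta_3+\theta_4)=0,$$ $$\mu_4f(\theta_3)+\mu_1f(\theta_3+\theta_4)+\mu_2f(\theta_3+\theta_4+\theta_1)=0,$$ $$\mu_1f(\theta_4)+\mu_2f(\theta_4+\theta_1)+\mu_3f(\theta_4+\theta_1+\theta_2)=0.$$ The tuples $(\theta_1,\pi-\theta_1,\pi-\theta_1,\theta_1)$ and $(\pi-\theta_1,\theta_1,\theta_1,\pi-\theta_1)$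 differ by the relabeling of satellites $1\leftrightarrow 3$, $2\leftrightarrow 4$, which preserves the masses when $\mu_1=\mu_3$ and $\mu_2=\mu_4$. *)

theory Defs
  imports Complex_Main
begin

text \<open>
  The mathematical domain of \<open>f\<close> is the open interval from \<open>0\<close> to \<open>2 * pi\<close>. In a central
  configuration all angles are positive with sum \<open>2 * pi\<close>, so every argument of \<open>f\<close> below lies
  in this interval.
\<close>

definition f :: "real \<Rightarrow> real" where
  "f x = sin x * (1 - 1 / (8 * \<bar>sin (x / 2) ^ 3\<bar>))"

definition central_configuration ::
    "real \<Rightarrow> real \<Rightarrow> real \<Rightarrow> real \<Rightarrow> real \<times> real \<times> real \<times> real \<Rightarrow> bool" where
  "central_configuration \<mu>1 \<mu>2 \<mu>3 \<mu>4 = (\<lambda>(\<theta>1, \<theta>2, \<theta>3, \<theta>4).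
     0 < \<theta>1 \<and> 0 < \<theta>2 \<and> 0 < \<theta>3 \<and> 0 < \<theta>4 \<and> \<theta>1 + \<theta>2 + \<theta>3 + \<theta>4 = 2 * pi \<and>
     \<mu>2 * f \<theta>1 + \<mu>3 * f (\<theta>1 + \<theta>2) + \<mu>4 * f (\<theta>1 + \<theta>2 + \<theta>3) = 0 \<and>
     \<mu>3 * f \<theta>2 + \<mu>4 * f (\<theta>2 + \<theta>3) + \<mu>1 * f (\<theta>2 + \<theta>3 + \<theta>4) = 0 \<and>
     \<mu>4 * f \<theta>3 + \<mu>1 * f (\<theta>3 + \<theta>4) + \<mu>2 * f (\<theta>3 + \<theta>4 + \<theta>1) = 0 \<and>
     \<mu>1 * f \<theta>4 + \<mu>2 * f (\<theta>4 + \<theta>1) + \<mu>3 * f (\<theta>4 + \<theta>1 + \<theta>2) = 0)"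

text \<open>The square is included here; it is the case where all angles equal \<open>pi / 2\<close>.\<close>

definition kite_configurations ::
    "real \<Rightarrow> real \<Rightarrow> real \<Rightarrow> real \<Rightarrow> (real \<times> real \<times> real \<times> real) set" where
  "kite_configurations \<mu>1 \<mu>2 \<mu>3 \<mu>4 =
     {(\<theta>1, \<theta>2, \<theta>3, \<theta>4). central_configuration \<mu>1 \<mu>2 \<mu>3 \<mu>4 (\<theta>1, \<theta>2, \<theta>3, \<theta>4) \<and>
        \<theta>1 = \<theta>4 \<and> \<theta>2 = \<theta>3 \<and> \<theta>3 = pi - \<theta>1}"

definition kite :: "real \<Rightarrow> real \<times> real \<times> real \<times> real" where
  "kite \<theta> = (\<theta>, pi - \<theta>, pi - \<theta>, \<theta>)"

definition square :: "real \<times> real \<times> real \<times> real" where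
  "square = (pi / 2, pi / 2, pi / 2, pi / 2)"

text \<open>
  The second alternative is the effect on kites of relabeling the satellites by exchanging
  1 with 3 and 2 with 4.
\<close>

definition same_configuration ::
    "((real \<times> real \<times> real \<times> real) \<times> (real \<times> real \<times> real \<times> real)) set" where
  "same_configuration =
     {(p, q). p = q \<or> (\<exists>\<theta>. p = (\<theta>, pi - \<theta>, pi - \<theta>, \<theta>) \<and> q = (pi - \<theta>, \<theta>, \<theta>, pi - \<theta>))}"

lemma equiv_same_configuration: "equiv UNIV same_configuration"
  by (rule equivI) (auto simp: same_configuration_def refl_on_def sym_def trans_def)

end

theory Submission
  imports Defs
begin

text \<open>
  For a kite the first and third equations hold by the symmetry \<open>f (2 * pi - x) = - f x\<close>, and the
  other two reduce to \<open>\<mu>1 * (f \<theta> - f (pi - \<theta>)) + \<mu>2 * f (2 * \<theta>) = 0\<close>. With \<open>c = cos (\<theta> / 2)\<close> and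
  \<open>s = sin (\<theta> / 2)\<close> the left-hand side is a positive multiple of
  \<open>(c - s) * (\<mu>2 * (c + s) * (64 * (s * c) ^ 3 - 1) - 4 * \<mu>1 * (1 + s * c))\<close>. The factor \<open>c - s\<close> gives
  the square. Since \<open>2 * s * c = sin \<theta>\<close> and \<open>c + s = sqrt (1 + sin \<theta>)\<close>, the other factor vanishes
  iff \<open>\<mu>1 / \<mu>2\<close> equals \<open>kite_ratio \<theta>\<close>, a function of \<open>sin \<theta>\<close> which is negative for \<open>sin \<theta> < 1 / 2\<close> and increases
  from \<open>0\<close> to \<open>7 * sqrt 2 / 6\<close> as \<open>\<theta>\<close> runs from \<open>pi / 6\<close> to \<open>pi / 2\<close>.
\<close>

definition kite_ratio :: "real \<Rightarrow> real" where
  "kite_ratio \<theta> = sqrt (1 + sin \<theta>) * (8 * sin \<theta> ^ 3 - 1) / (4 + 2 * sin \<theta>)"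

section \<open>Reduction of the kite equations to one factored equation\<close>

lemma f_reflect: "f (2 * pi - x) = - f x"
proof -
  have "sin ((2 * pi - x) / 2) = sin (x / 2)"
    by (simp add: diff_divide_distrib)
  moreover have "sin (2 * pi - x) = - sin x"
    by (simp add: sin_diff)
  ultimately show ?thesis by (simp add: f_def)
qed

lemma f_pi [simp]: "f pi = 0"
  by (simp add: f_def)

lemma central_configuration_kite_iff:
  "central_configuration m n m n (kite \<theta>) \<longleftrightarrow>
     0 < \<theta> \<and> \<theta> < pi \<and> m * (f \<theta> - f (pi - \<theta>)) + n * f (2 * \<theta>) = 0"
proof -
  have "f (pi + \<theta>) = - f (pi - \<theta>)"
    using f_reflect[of "pi - \<theta>"] by (simp add: algebra_simps)
  moreover have "pi - \<theta> + \<theta> + \<theta> = pi + \<theta>" "\<theta> + \<theta> + (pi - \<theta>) = pi + \<theta>"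
    by simp_all
  \<comment> \<open>These sums keep the exact association that
    \<open>central_configuration_def\<close> produces, so that they can serve as rewrite rules
    below.\<close>
  ultimately have plus: "f (pi - \<theta> + \<theta> + \<theta>) = - f (pi - \<theta>)"
    "f (\<theta> + \<theta> + (pi - \<theta>)) = - f (pi - \<theta>)"
    by metis+
  have minus: "f (\<theta> + (pi - \<theta>) + (pi - \<theta>)) = - f \<theta>" "f (pi - \<theta> + (pi - \<theta>) + \<theta>) = - f \<theta>"
    "f (pi - \<theta> + (pi - \<theta>)) = - f (2 * \<theta>)"
    using f_reflect[of \<theta>] f_reflect[of "2 * \<theta>"] by (simp_all add: algebra_simps)
  have zero: "f (\<theta> + (pi - \<theta>)) = 0" "f (pi - \<theta> + \<theta>) = 0" and double: "f (\<theta> + \<theta>) = f (2 * \<theta>)"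
    by (simp_all flip: mult_2)
  show ?thesis
    unfolding central_configuration_def kite_def prod.case plus minus zero double
    by (auto simp: right_diff_distrib)
qed

text \<open>On this range both half-angle values are positive, so their sum is the nonnegative
  square root of its own square.\<close>

lemma sin_half_add_cos_half:
  assumes "0 < \<theta>" "\<theta> < pi"
  shows "sin (\<theta> / 2) + cos (\<theta> / 2) = sqrt (1 + sin \<theta>)"
proof -
  have "0 < sin (\<theta> / 2)" "0 < cos (\<theta> / 2)"
    using assms by (auto intro!: sin_gt_zero cos_gt_zero)
  moreover have "(sin (\<theta> / 2) + cos (\<theta> / 2))\<^sup>2 = 1 + sin \<theta>"
    using sin_double[of "\<theta> / 2"] by (simp add: power2_sum)
  ultimately show ?thesis
    by (metis add_pos_pos less_imp_le real_sqrt_unique)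
qed

text \<open>The factor \<open>32 * s ^ 3 * c ^ 3\<close> clears the cubic denominators;
  \<open>f (2 * \<theta>)\<close> has denominator \<open>64 * (s * c) ^ 3\<close> but also a factor
  2 from the double angle. What remains are differences of squares and of cubes, which share
  \<open>c - s\<close>.\<close>

lemma kite_equation_factor:
  assumes "0 < \<theta>" "\<theta> < pi"
  defines "s \<equiv> sin (\<theta> / 2)" and "c \<equiv> cos (\<theta> / 2)"
  shows "32 * s ^ 3 * c ^ 3 * (m * (f \<theta> - f (pi - \<theta>)) + n * f (2 * \<theta>)) =
    sin \<theta> * (c - s) * (n * (s + c) * (64 * (s * c) ^ 3 - 1) - 4 * m * (1 + s * c))"
proof -
  have pos: "0 < s" "0 < c"
    using assms by (auto intro!: sin_gt_zero cos_gt_zero)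
  have sin: "sin \<theta> = 2 * (s * c)"
    using sin_double[of "\<theta> / 2"] by (simp add: s_def c_def)
  have cos: "cos \<theta> = c\<^sup>2 - s\<^sup>2"
    using cos_double[of "\<theta> / 2"] by (simp add: s_def c_def)
  have unit: "s\<^sup>2 + c\<^sup>2 = 1"
    by (simp add: s_def c_def)
  have "sin ((pi - \<theta>) / 2) = c"
    by (simp add: c_def diff_divide_distrib cos_sin_eq)
  then have f2: "f (pi - \<theta>) = sin \<theta> * (1 - 1 / (8 * c ^ 3))"
    using pos by (simp add: f_def)
  have f1: "f \<theta> = sin \<theta> * (1 - 1 / (8 * s ^ 3))"
    using pos by (simp add: f_def flip: s_def)
  have f3: "f (2 * \<theta>) = 2 * sin \<theta> * (c\<^sup>2 - s\<^sup>2) * (1 - 1 / (64 * (s * c) ^ 3))"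
    using pos by (simp add: f_def sin_double cos sin power_mult_distrib abs_mult)
  have "32 * s ^ 3 * c ^ 3 * (m * (f \<theta> - f (pi - \<theta>)) + n * f (2 * \<theta>)) =
    sin \<theta> * (n * (c\<^sup>2 - s\<^sup>2) * (64 * (s * c) ^ 3 - 1) - 4 * m * (c ^ 3 - s ^ 3))"
  proof -
    \<comment> \<open>The cubes become atoms \<open>S\<close> and \<open>C\<close>, with
      \<open>u\<close> for \<open>sin \<theta>\<close> and \<open>d\<close> for
      \<open>c\<^sup>2 - s\<^sup>2\<close>, so that clearing denominators does not touch the
      powers.\<close>
    have "32 * S * C * (m * (u * (1 - 1 / (8 * S)) - u * (1 - 1 / (8 * C))) +
        n * (2 * u * d * (1 - 1 / (64 * (S * C))))) =
      u * (n * d * (64 * (S * C) - 1) - 4 * m * (C - S))" if "S > 0" "C > 0" for S C u d :: real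
      using that by (simp add: field_simps)
    from this[of "s ^ 3" "c ^ 3"] show ?thesis
      unfolding f1 f2 f3 power_mult_distrib using pos by simp
  qed
  also have "c ^ 3 - s ^ 3 = (c - s) * (s\<^sup>2 + c\<^sup>2 + s * c)"
    by (simp add: algebra_simps power2_eq_square power3_eq_cube)
  also have "\<dots> = (c - s) * (1 + s * c)"
    by (simp add: unit)
  also have "c\<^sup>2 - s\<^sup>2 = (c - s) * (s + c)"
    by (simp add: algebra_simps power2_eq_square)
  finally show ?thesis
    by (simp add: algebra_simps)
qed

lemma sin_half_eq_cos_half_iff:
  assumes "0 < \<theta>" "\<theta> < pi"
  shows "cos (\<theta> / 2) - sin (\<theta> / 2) = 0 \<longleftrightarrow> \<theta> = pi / 2"
proof
  assume "cos (\<theta> / 2) - sin (\<theta> / 2) = 0"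
  then have "cos (\<theta> / 2) = cos (pi / 2 - \<theta> / 2)"
    by (simp add: cos_diff)
  then have "\<theta> / 2 = pi / 2 - \<theta> / 2"
    by (rule cos_inj_pi[rotated -1]) (use assms in auto)
  then show "\<theta> = pi / 2" by simp
next
  assume "\<theta> = pi / 2"
  then have "\<theta> / 2 = pi / 4"
    by simp
  then show "cos (\<theta> / 2) - sin (\<theta> / 2) = 0"
    by (simp only: sin_45 cos_45 diff_self)
qed

text \<open>The square solves the equation for all masses, because \<open>c - s\<close> vanishes
  there. Any other kite forces the mass ratio, because the remaining factor is linear in
  \<open>m\<close> and \<open>n\<close>.\<close>

lemma kite_mem_iff:
  assumes "0 < m" "0 < n"
  shows "kite \<theta> \<in> kite_configurations m n m n \<longleftrightarrow>
    0 < \<theta> \<and> \<theta> < pi \<and> (\<theta> = pi / 2 \<or> kite_ratio \<theta> = m / n)"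
proof (cases "0 < \<theta> \<and> \<theta> < pi")
  case True
  define s c where "s = sin (\<theta> / 2)" and "c = cos (\<theta> / 2)"
  have pos: "0 < s" "0 < c" "0 < sin \<theta>"
    using True by (auto simp: s_def c_def intro!: sin_gt_zero cos_gt_zero)
  have sin: "s * c = sin \<theta> / 2"
    using sin_double[of "\<theta> / 2"] by (simp add: s_def c_def)
  have ratio: "kite_ratio \<theta> * (4 + 2 * sin \<theta>) = (s + c) * (8 * sin \<theta> ^ 3 - 1)"
    using sin_half_add_cos_half[of \<theta>] True pos by (simp add: kite_ratio_def s_def c_def)
  have "m * (f \<theta> - f (pi - \<theta>)) + n * f (2 * \<theta>) = 0 \<longleftrightarrow>
      32 * s ^ 3 * c ^ 3 * (m * (f \<theta> - f (pi - \<theta>)) + n * f (2 * \<theta>)) = 0"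
    using pos by simp
  also have "\<dots> \<longleftrightarrow> c - s = 0 \<or> n * (s + c) * (64 * (s * c) ^ 3 - 1) - 4 * m * (1 + s * c) = 0"
    unfolding s_def c_def using kite_equation_factor[of \<theta> m n] True pos by simp
  also have "c - s = 0 \<longleftrightarrow> \<theta> = pi / 2"
    unfolding s_def c_def using sin_half_eq_cos_half_iff True by blast
  also have "n * (s + c) * (64 * (s * c) ^ 3 - 1) - 4 * m * (1 + s * c) =
      n * (4 + 2 * sin \<theta>) * (kite_ratio \<theta> - m / n)"
  proof -
    have "n * (s + c) * (64 * (s * c) ^ 3 - 1) = n * (kite_ratio \<theta> * (4 + 2 * sin \<theta>))"
      unfolding ratio sin by (simp add: power_divide)
    then show ?thesis
      using assms unfolding sin by (simp add: algebra_simps)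
  qed
  also have "\<dots> = 0 \<longleftrightarrow> kite_ratio \<theta> = m / n"
    using assms pos by simp
  finally show ?thesis
    using True central_configuration_kite_iff[of m n \<theta>]
    by (simp add: kite_configurations_def kite_def)
next
  case False
  then show ?thesis
    using central_configuration_kite_iff[of m n \<theta>]
    by (auto simp: kite_configurations_def kite_def)
qed

lemma kite_configurations_subset_range: "kite_configurations m n m' n' \<subseteq> range kite"
  by (auto simp: kite_configurations_def kite_def)

section \<open>Sign, monotonicity and range of \<open>kite_ratio\<close>\<close>

lemma kite_ratio_reflect: "kite_ratio (pi - \<theta>) = kite_ratio \<theta>"
  by (simp add: kite_ratio_def)

lemma kite_ratio_pi_div_6: "kite_ratio (pi / 6) = 0"
  by (simp add: kite_ratio_def sin_30 power_divide)

lemma kite_ratio_pi_half: "kite_ratio (pi / 2) = 7 * sqrt 2 / 6"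
  by (simp add: kite_ratio_def)

text \<open>This is where the bound \<open>pi / 6\<close> comes from: a quotient of positive masses
  cannot be attained at such angles.\<close>

lemma kite_ratio_nonpos:
  assumes "0 < \<theta>" "\<theta> \<le> pi / 6"
  shows "kite_ratio \<theta> \<le> 0"
proof -
  have "0 < sin \<theta>"
    using assms by (intro sin_gt_zero) auto
  moreover have "sin \<theta> \<le> 1 / 2"
    using sin_monotone_2pi_le[of \<theta> "pi / 6"] assms by (simp add: sin_30)
  moreover from calculation have "sin \<theta> ^ 3 \<le> (1 / 2) ^ 3"
    by (intro power_mono) auto
  ultimately show ?thesis
    unfolding kite_ratio_def
    by (intro divide_nonpos_pos mult_nonneg_nonpos) (auto simp: power_divide)
qed

lemma kite_ratio_strict_mono:
  assumes "pi / 6 \<le> a" "a < b" "b \<le> pi / 2"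
  shows "kite_ratio a < kite_ratio b"
proof -
  define u v where "u = sin a" and "v = sin b"
  have "u < v"
    unfolding u_def v_def using assms by (intro sin_monotone_2pi) auto
  have "1 / 2 \<le> u"
    using sin_monotone_2pi_le[of "pi / 6" a] assms by (simp add: u_def sin_30)
  then have "(1 / 2) ^ 3 \<le> u ^ 3"
    by (intro power_mono) auto
  then have u3: "0 \<le> 8 * u ^ 3 - 1"
    by (simp add: power_divide)
  have uv: "u ^ 3 < v ^ 3" "u\<^sup>2 < v\<^sup>2"
    using \<open>u < v\<close> \<open>1 / 2 \<le> u\<close> by (auto intro!: power_strict_mono)
  \<comment> \<open>This is the cross-multiplied difference of the two fractions, grouped into terms
    that are visibly positive.\<close>
  have "0 < 16 * (v ^ 3 - u ^ 3) + 8 * (u * v) * (v\<^sup>2 - u\<^sup>2) + (v - u)"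
    using uv \<open>u < v\<close> \<open>1 / 2 \<le> u\<close> by (intro add_pos_pos mult_pos_pos) auto
  also have "\<dots> = (8 * v ^ 3 - 1) * (2 + u) - (8 * u ^ 3 - 1) * (2 + v)"
    by (simp add: algebra_simps power2_eq_square power3_eq_cube)
  finally have "(8 * u ^ 3 - 1) / (2 + u) < (8 * v ^ 3 - 1) / (2 + v)"
    using \<open>u < v\<close> \<open>1 / 2 \<le> u\<close> by (simp add: frac_less_eq divide_simps)
  \<comment> \<open>Multiplying the two strict inequalities requires nonnegative left factors, which
    \<open>u3\<close> supplies; it rests on \<open>pi / 6 \<le> a\<close>.\<close>
  then have "sqrt (1 + u) * ((8 * u ^ 3 - 1) / (2 + u)) < sqrt (1 + v) * ((8 * v ^ 3 - 1) / (2 + v))"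
    using \<open>u < v\<close> \<open>1 / 2 \<le> u\<close> u3 by (intro mult_strict_mono') auto
  moreover have "kite_ratio x = sqrt (1 + sin x) * ((8 * sin x ^ 3 - 1) / (2 + sin x)) / 2" for x
    using sin_ge_minus_one[of x] by (simp add: kite_ratio_def field_simps)
  ultimately show ?thesis
    by (simp only: u_def v_def divide_strict_right_mono zero_less_numeral)
qed

lemma continuous_on_kite_ratio: "continuous_on A kite_ratio"
proof -
  have "4 + 2 * sin x \<noteq> 0" for x :: real
    using sin_ge_minus_one[of x] by linarith
  then show ?thesis
    unfolding kite_ratio_def by (auto intro!: continuous_intros)
qed

text \<open>Strict monotonicity gives injectivity, and the intermediate value theorem between the
  two endpoint values gives surjectivity.\<close>

lemma bij_betw_kite_ratio:
  "bij_betw kite_ratio {pi / 6 <..< pi / 2} {0 <..< 7 * sqrt 2 / 6}"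
  unfolding bij_betw_def
proof
  show "inj_on kite_ratio {pi / 6 <..< pi / 2}"
    by (rule strict_mono_on_imp_inj_on) (auto intro!: strict_mono_onI kite_ratio_strict_mono)
  show "kite_ratio ` {pi / 6 <..< pi / 2} = {0 <..< 7 * sqrt 2 / 6}"
  proof (intro equalityI subsetI)
    fix y assume "y \<in> kite_ratio ` {pi / 6 <..< pi / 2}"
    then obtain x where "pi / 6 < x" "x < pi / 2" "y = kite_ratio x" by auto
    then show "y \<in> {0 <..< 7 * sqrt 2 / 6}"
      using kite_ratio_strict_mono[of "pi / 6" x] kite_ratio_strict_mono[of x "pi / 2"]
      by (simp add: kite_ratio_pi_div_6 kite_ratio_pi_half)
  next
    fix y :: real assume y: "y \<in> {0 <..< 7 * sqrt 2 / 6}"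
    then obtain x where x: "pi / 6 \<le> x" "x \<le> pi / 2" "kite_ratio x = y"
      using IVT'[of kite_ratio "pi / 6" y "pi / 2"] continuous_on_kite_ratio
      by (auto simp: kite_ratio_pi_div_6 kite_ratio_pi_half)
    then have "x \<noteq> pi / 6" "x \<noteq> pi / 2"
      using y kite_ratio_pi_div_6 kite_ratio_pi_half by force+
    with x show "y \<in> kite_ratio ` {pi / 6 <..< pi / 2}"
      by force
  qed
qed

lemma kite_ratio_pos_imp_gt_pi_div_6:
  assumes "0 < \<theta>" "\<theta> < pi / 2" "0 < kite_ratio \<theta>"
  shows "\<theta> \<in> {pi / 6 <..< pi / 2}"
  using assms kite_ratio_nonpos[of \<theta>] by force

section \<open>The kite angle as a function of the mass ratio\<close>

lemma bij_betw_reciprocal: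
  fixes c :: real
  assumes "0 < c"
  shows "bij_betw (\<lambda>x. 1 / x) {c <..} {0 <..< 1 / c}"
proof (rule bij_betw_byWitness[where f' = "\<lambda>x. 1 / x"])
  have "1 / x < 1 / c" if "c < x" for x
    using that assms by (intro divide_strict_left_mono) auto
  then show "(\<lambda>x. 1 / x) ` {c <..} \<subseteq> {0 <..< 1 / c}"
    using assms by auto
  have "c < 1 / y" if "0 < y" "y < 1 / c" for y
    using that assms by (simp add: pos_less_divide_eq mult.commute)
  then show "(\<lambda>x. 1 / x) ` {0 <..< 1 / c} \<subseteq> {c <..}"
    by auto
qed auto

lemma reciprocal_critical_ratio: "1 / (3 * sqrt 2 / 7) = 7 * sqrt 2 / (6 :: real)"
  by (simp add: field_simps)

lemma bij_betw_inverse_mass_ratio: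
  "bij_betw (\<lambda>x. 1 / x) {3 * sqrt 2 / 7 <..} {0 <..< 7 * sqrt 2 / 6}"
  using bij_betw_reciprocal[of "3 * sqrt 2 / 7"] unfolding reciprocal_critical_ratio by simp

text \<open>The argument \<open>x\<close> stands for \<open>\<mu>2 / \<mu>1\<close>, while
  \<open>kite_ratio\<close> takes the value \<open>\<mu>1 / \<mu>2\<close> on kites other than the
  square; hence the reciprocal.\<close>

definition kite_angle :: "real \<Rightarrow> real" where
  "kite_angle x = the_inv_into {pi / 6 <..< pi / 2} kite_ratio (1 / x)"

lemma bij_betw_kite_angle: "bij_betw kite_angle {3 * sqrt 2 / 7 <..} {pi / 6 <..< pi / 2}"
  using bij_betw_trans[OF bij_betw_inverse_mass_ratio bij_betw_the_inv_into[OF bij_betw_kite_ratio]]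
  by (simp add: kite_angle_def[abs_def] comp_def)

lemma kite_ratio_eq_iff:
  assumes "3 * sqrt 2 / 7 < x" "\<theta> \<in> {pi / 6 <..< pi / 2}"
  shows "kite_ratio \<theta> = 1 / x \<longleftrightarrow> \<theta> = kite_angle x"
proof -
  have "1 / x \<in> {0 <..< 7 * sqrt 2 / 6}"
    using bij_betw_apply[OF bij_betw_inverse_mass_ratio, of x] assms(1) by simp
  then show ?thesis
    unfolding kite_angle_def using assms(2)
    by (metis bij_betw_kite_ratio bij_betw_imp_inj_on f_the_inv_into_f_bij_betw the_inv_into_f_f)
qed

section \<open>Counting kites up to relabeling\<close>

lemma square_eq_kite: "square = kite (pi / 2)"
  by (simp add: square_def kite_def)

text \<open>For an equivalence relation, classes agree iff their representatives are related, and
  relabeling replaces the angle by its supplement.\<close>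

lemma same_configuration_kite_iff:
  "same_configuration `` {kite a} = same_configuration `` {kite b} \<longleftrightarrow> a = b \<or> a = pi - b"
  unfolding eq_equiv_class_iff[OF equiv_same_configuration UNIV_I UNIV_I]
  by (auto simp: same_configuration_def kite_def)

text \<open>Each class has a representative with angle at most \<open>pi / 2\<close>, so both cases
  of the theorem come down to the number of solutions of \<open>kite_ratio \<theta> = m / n\<close>
  in the open interval.\<close>

lemma kite_configurations_quotient:
  assumes "0 < m" "0 < n"
  shows "kite_configurations m n m n // same_configuration =
    insert (same_configuration `` {square})
      ((\<lambda>\<theta>. same_configuration `` {kite \<theta>}) `
        {\<theta> \<in> {pi / 6 <..< pi / 2}. kite_ratio \<theta> = m / n})"
    (is "?Q = insert ?s (?k ` ?A)")
proof (intro equalityI subsetI)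
  fix X assume "X \<in> ?Q"
  then obtain p where "X = same_configuration `` {p}" and "p \<in> kite_configurations m n m n"
    by (rule quotientE)
  moreover from this(2) obtain \<theta> where "p = kite \<theta>"
    using kite_configurations_subset_range by blast
  ultimately have X: "X = ?k \<theta>" and mem: "kite \<theta> \<in> kite_configurations m n m n"
    by simp_all
  have \<theta>: "0 < \<theta>" "\<theta> < pi" "\<theta> = pi / 2 \<or> kite_ratio \<theta> = m / n"
    using mem kite_mem_iff[OF assms] by auto
  have pos: "0 < m / n" using assms by simp
  consider "\<theta> = pi / 2" | "\<theta> < pi / 2" "kite_ratio \<theta> = m / n" | "pi / 2 < \<theta>" "kite_ratio \<theta> = m / n"
    using \<theta> by linarith
  then show "X \<in> insert ?s (?k ` ?A)"
  proof cases
    case 1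
    then show ?thesis unfolding X square_eq_kite by blast
  next
    case 2
    then have "\<theta> \<in> ?A"
      using kite_ratio_pos_imp_gt_pi_div_6[OF \<theta>(1)] pos by simp
    then show ?thesis
      unfolding X by blast
  next
    case 3
    \<comment> \<open>The relabeled kite has the same sine, hence the same ratio, and its angle lies
      below \<open>pi / 2\<close>.\<close>
    then have "pi - \<theta> \<in> {pi / 6 <..< pi / 2}"
      using \<theta>(2) pos by (intro kite_ratio_pos_imp_gt_pi_div_6) (simp_all add: kite_ratio_reflect)
    with 3 have "pi - \<theta> \<in> ?A"
      by (simp add: kite_ratio_reflect)
    moreover have "X = ?k (pi - \<theta>)"
      by (simp add: X same_configuration_kite_iff)
    ultimately show ?thesis by blast
  qed
next
  fix X assume "X \<in> insert ?s (?k ` ?A)"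
  then obtain \<theta> where X: "X = ?k \<theta>" and \<theta>: "\<theta> = pi / 2 \<or> \<theta> \<in> ?A"
    unfolding square_eq_kite by blast
  from \<theta> have "0 < \<theta> \<and> \<theta> < pi \<and> (\<theta> = pi / 2 \<or> kite_ratio \<theta> = m / n)"
  proof
    assume half: "\<theta> = pi / 2"
    show ?thesis unfolding half by simp
  next
    assume "\<theta> \<in> ?A"
    then show ?thesis using pi_gt_zero by simp
  qed
  then have "kite \<theta> \<in> kite_configurations m n m n"
    using kite_mem_iff[OF assms] by blast
  then show "X \<in> ?Q"
    unfolding X by (rule quotientI)
qed

theorem theorem4:
  shows
    "(\<forall>\<mu>1 \<mu>2 \<mu>3 \<mu>4 :: real.
        0 < \<mu>1 \<and> 0 < \<mu>2 \<and> 0 < \<mu>3 \<and> 0 < \<mu>4 \<and> \<mu>1 = \<mu>3 \<and> \<mu>2 = \<mu>4 \<longrightarrow>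
        (\<mu>2 / \<mu>1 \<le> 3 * sqrt 2 / 7 \<longrightarrow>
           kite_configurations \<mu>1 \<mu>2 \<mu>3 \<mu>4 // same_configuration =
             {same_configuration `` {square}}) \<and>
        (\<mu>2 / \<mu>1 > 3 * sqrt 2 / 7 \<longrightarrow>
           card (kite_configurations \<mu>1 \<mu>2 \<mu>3 \<mu>4 // same_configuration) = 2 \<and>
           (\<exists>\<theta>1 \<in> {pi / 6 <..< pi / 2}.
              kite_configurations \<mu>1 \<mu>2 \<mu>3 \<mu>4 // same_configuration =
                {same_configuration `` {square}, same_configuration `` {kite \<theta>1}})))
     \<and>
     (\<exists>g :: real \<Rightarrow> real.
        (\<forall>\<mu>1 \<mu>2 \<mu>3 \<mu>4 :: real.
           0 < \<mu>1 \<and> 0 < \<mu>2 \<and> 0 < \<mu>3 \<and> 0 < \<mu>4 \<and> \<mu>1 = \<mu>3 \<and> \<mu>2 = \<mu>4 \<and>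
           \<mu>2 / \<mu>1 > 3 * sqrt 2 / 7 \<longrightarrow>
           (\<forall>\<theta>1 \<in> {pi / 6 <..< pi / 2}.
              kite \<theta>1 \<in> kite_configurations \<mu>1 \<mu>2 \<mu>3 \<mu>4 \<longleftrightarrow> \<theta>1 = g (\<mu>2 / \<mu>1))) \<and>
        bij_betw g {3 * sqrt 2 / 7 <..} {pi / 6 <..< pi / 2})"
proof (intro conjI exI[of _ kite_angle] bij_betw_kite_angle allI impI ballI; elim conjE)
  fix \<mu>1 \<mu>2 \<mu>3 \<mu>4 :: real
  assume pos: "0 < \<mu>1" "0 < \<mu>2" and eq: "\<mu>1 = \<mu>3" "\<mu>2 = \<mu>4"
  let ?A = "{\<theta> \<in> {pi / 6 <..< pi / 2}. kite_ratio \<theta> = \<mu>1 / \<mu>2}"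
  have quotient: "kite_configurations \<mu>1 \<mu>2 \<mu>3 \<mu>4 // same_configuration =
      insert (same_configuration `` {square}) ((\<lambda>\<theta>. same_configuration `` {kite \<theta>}) ` ?A)"
    using kite_configurations_quotient[OF pos] by (simp only: eq)
  {
    assume "\<mu>2 / \<mu>1 \<le> 3 * sqrt 2 / 7"
    \<comment> \<open>Taking reciprocals puts \<open>\<mu>1 / \<mu>2\<close> at or above the
      supremum of the open range of \<open>kite_ratio\<close>, so no angle solves the
      equation.\<close>
    then have "7 * sqrt 2 / 6 \<le> \<mu>1 / \<mu>2"
      using pos divide_left_mono[of "\<mu>2 / \<mu>1" "3 * sqrt 2 / 7" 1]
      unfolding reciprocal_critical_ratio by simp
    then have "kite_ratio \<theta> \<noteq> \<mu>1 / \<mu>2" if "\<theta> \<in> {pi / 6 <..< pi / 2}" for \<theta>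
      using bij_betw_apply[OF bij_betw_kite_ratio that] by (simp only: greaterThanLessThan_iff) linarith
    then have "?A = {}"
      by blast
    then show "kite_configurations \<mu>1 \<mu>2 \<mu>3 \<mu>4 // same_configuration = {same_configuration `` {square}}"
      by (simp only: quotient image_empty image_insert)
  next
    assume gt: "3 * sqrt 2 / 7 < \<mu>2 / \<mu>1"
    define \<theta> where "\<theta> = kite_angle (\<mu>2 / \<mu>1)"
    have \<theta>: "\<theta> \<in> {pi / 6 <..< pi / 2}"
      using bij_betw_apply[OF bij_betw_kite_angle] gt by (simp add: \<theta>_def)
    then have "?A = {\<theta>}"
      using kite_ratio_eq_iff[OF gt] by (auto simp: \<theta>_def)
    then have Q: "kite_configurations \<mu>1 \<mu>2 \<mu>3 \<mu>4 // same_configuration =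
        {same_configuration `` {square}, same_configuration `` {kite \<theta>}}"
      by (simp only: quotient image_empty image_insert)
    with \<theta> show "\<exists>\<theta>1 \<in> {pi / 6 <..< pi / 2}. kite_configurations \<mu>1 \<mu>2 \<mu>3 \<mu>4 // same_configuration =
        {same_configuration `` {square}, same_configuration `` {kite \<theta>1}}" ..
    \<comment> \<open>The angle \<open>pi / 2\<close> is its own supplement, so equal classes would
      force \<open>\<theta> = pi / 2\<close>.\<close>
    have "same_configuration `` {square} \<noteq> same_configuration `` {kite \<theta>}"
      using \<theta> by (auto simp: square_eq_kite same_configuration_kite_iff)
    then show "card (kite_configurations \<mu>1 \<mu>2 \<mu>3 \<mu>4 // same_configuration) = 2"
      by (simp add: Q)
  next
    fix \<theta>1 assume gt: "3 * sqrt 2 / 7 < \<mu>2 / \<mu>1" and \<theta>1: "\<theta>1 \<in> {pi / 6 <..< pi / 2}"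
    have "kite \<theta>1 \<in> kite_configurations \<mu>1 \<mu>2 \<mu>3 \<mu>4 \<longleftrightarrow> kite_ratio \<theta>1 = \<mu>1 / \<mu>2"
      using kite_mem_iff[OF pos, of \<theta>1] eq \<theta>1 by auto
    also have "\<dots> \<longleftrightarrow> \<theta>1 = kite_angle (\<mu>2 / \<mu>1)"
      using kite_ratio_eq_iff[OF gt \<theta>1] by simp
    finally show "kite \<theta>1 \<in> kite_configurations \<mu>1 \<mu>2 \<mu>3 \<mu>4 \<longleftrightarrow> \<theta>1 = kite_angle (\<mu>2 / \<mu>1)" .
  }
qed

end
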